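(* Let $m,n$ be positive integers, let $\mathcal{M}=(\mathcal{M}_{kl})$ be a positive definite symmetric integral $m\times m$ matrix and let $s=(s_{kj})\in\mathbb{Z}^{(m,n)}$. Then for every Schwartz function $f\in\mathscr{S}(\mathbb{R}^{(m,n)})$ we have $$\Theta_f^{[\mathcal{M}]}(\tau+2,\phi\,;\,\lambda,\ s-2\lambda+\mu,\ \kappa-s\,{}^t\lambda)=\Theta_f^{[\mathcal{M}]}(\tau,\phi\,;\lambda,\mu,\kappa)$$ for all $(\tau,\phi)\in SL(2,\mathbb{R})$ (with $\tau\in\mathbb{H}_1$, $\phi\in[0,2\pi)$) and all $(\lambda,\mu;\kappa)\in H_{\mathbb{R}}^{(n,m)}$.
   Context: Notation: $F^{(k,l)}$ is the set of $k\times l$ matrices over $F$; ${}^tA$ is the transpose; $\sigma(A)$ is the trace of a square matrix $A$; $i=\sqrt{-1}$; $\mathbb{H}_1=\{\tau=u+iv\in\mathbb{C}: v>0\}$. Heisenberg group: $H_{\mathbb{R}}^{(n,m)}=\{(\lambda,\mu;\kappa): \lambda,\mu\in\mathbb{R}^{(m,n)},\ \kappa\in\mathbb{R}^{(m,m)},\ \kappa+\mu\,{}^t\lambda \text{ symmetric}\}$, with multiplication $(\lambda,\mu;\kappa)\circ(\lambda',\mu';\kappa')=(\lambda+\lambda',\mu+\mu';\kappa+\kappa'+\lambda\,{}^t\mu'-\mu\,{}^t\lambda')$. For $x,y\in\mathbb{R}^{(m,n)}$ put $(x,y)_{\mathcal{M}}=\sigma({}^tx\mathcal{M}y)$ and $\|x\|_{\mathcal{M}}=\sqrt{(x,x)_{\mathcal{M}}}$.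 Schrödinger representation: for $(\lambda,\mu;\kappa)\in H_{\mathbb{R}}^{(n,m)}$ and $f\in L^2(\mathbb{R}^{(m,n)})$, $$[\mathscr{W}_{\mathcal{M}}(\lambda,\mu;\kappa)f](x)=e^{\pi i\,\sigma\{\mathcal{M}(\kappa+\mu\,{}^t\lambda+2x\,{}^t\mu)\}}f(x+\lambda).$$ Coordinates on $SL(2,\mathbb{R})$: by the Iwasawa decomposition each element is uniquely $$(\tau,\phi):=\begin{pmatrix}1&u\\0&1\end{pmatrix}\begin{pmatrix}v^{1/2}&0\\0&v^{-1/2}\end{pmatrix}\begin{pmatrix}\cos\phi&-\sin\phi\\ \sin\phi&\cos\phi\end{pmatrix},\quad \tau=u+iv\in\mathbb{H}_1,\ \phi\in[0,2\pi).$$ Operators $R_{\mathcal{M}}(\tau,\phi)$: $[R_{\mathcal{M}}(\tau,\phi)f](x)=v^{mn/4}e^{\pi i u\|x\|_{\mathcal{M}}^2}[R_{\mathcal{M}}(i,\phi)f](v^{1/2}x)$, where $[R_{\mathcal{M}}(i,\phi)f](x)$ equals $f(x)$ if $\phi\equiv0 \bmod 2\pi$, equals $f(-x)$ if $\phi\equiv\pi\bmod 2\pi$, and otherwise equals $$(\det\mathcal{M})^{\frac n2}|\sin\phi|^{-\frac{mn}2}\int_{\mathbb{R}^{(m,n)}}\exp\left(\pi i\,\frac{(\|x\|_{\mathcal{M}}^2+\|y\|_{\mathcal{M}}^2)\cos\phi-2(x,y)_{\mathcal{M}}}{\sin\phi}\right)f(y)\,dy.$$ Theta sum of index $\mathcal{M}$: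 for $f\in\mathscr{S}(\mathbb{R}^{(m,n)})$, $$\Theta_f^{[\mathcal{M}]}(\tau,\phi;\lambda,\mu,\kappa):=\sum_{\omega\in\mathbb{Z}^{(m,n)}}\left[\mathscr{W}_{\mathcal{M}}(\lambda,\mu;\kappa)R_{\mathcal{M}}(\tau,\phi)f\right](\omega).$$ *)

theory Defs
  imports "HOL-Analysis.Analysis" "HOL-Library.Real_Mod"
begin

text \<open>The space of real \<open>m \<times> n\<close> matrices is \<^typ>\<open>real^'n^'m\<close>, where \<open>m = CARD('m)\<close>
  and \<open>n = CARD('n)\<close>; its \<^const>\<open>Basis\<close> consists of the matrix units, its norm is the
  Frobenius norm, and \<^const>\<open>lborel\<close> is Lebesgue measure in the matrix entries.\<close>

definition integral_matrices :: "(real^'n^'m) set" where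
  "integral_matrices = {A. \<forall>k j. A $ k $ j \<in> \<int>}"

definition symmetric_matrix :: "real^'m^'m \<Rightarrow> bool" where
  "symmetric_matrix A \<longleftrightarrow> transpose A = A"

definition pos_def_matrix :: "real^'m^'m \<Rightarrow> bool" where
  "pos_def_matrix A \<longleftrightarrow> (\<forall>x. x \<noteq> 0 \<longrightarrow> x \<bullet> (A *v x) > 0)"

definition heisenberg :: "((real^'n^'m) \<times> (real^'n^'m) \<times> (real^'m^'m)) set" where
  "heisenberg = {(l, \<mu>, \<kappa>). symmetric_matrix (\<kappa> + \<mu> ** transpose l)}"

definition inner_M :: "real^'m^'m \<Rightarrow> real^'n^'m \<Rightarrow> real^'n^'m \<Rightarrow> real" where
  "inner_M M x y = trace (transpose x ** M ** y)"

definition norm_M :: "real^'m^'m \<Rightarrow> real^'n^'m \<Rightarrow> real" where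
  "norm_M M x = sqrt (inner_M M x x)"

fun iterated_partial ::
  "'a list \<Rightarrow> ('a::euclidean_space \<Rightarrow> 'b::real_normed_vector) \<Rightarrow> 'a \<Rightarrow> 'b" where
  "iterated_partial [] f = f"
| "iterated_partial (b # bs) f = (\<lambda>x. frechet_derivative (iterated_partial bs f) (at x) b)"

text \<open>A partial derivative of arbitrary order is given by the list of coordinate directions in
  which one differentiates. A function is smooth iff all these partial derivatives exist and are
  differentiable everywhere, so the first conjunct also excludes the arbitrary values of
  \<^const>\<open>frechet_derivative\<close>. The exponents \<open>\<alpha>\<close> are the multi-index of a monomial.\<close>

definition schwartz_space :: "('a::euclidean_space \<Rightarrow> complex) set" where
  "schwartz_space = {f. \<forall>bs. set bs \<subseteq> Basis \<longrightarrow>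
     (\<forall>x. iterated_partial bs f differentiable (at x)) \<and>
     (\<forall>\<alpha> :: 'a \<Rightarrow> nat.
        bounded (range (\<lambda>x. (\<Prod>b\<in>Basis. (x \<bullet> b) ^ \<alpha> b) *\<^sub>R iterated_partial bs f x)))}"

definition schroedinger_W ::
  "real^'m^'m \<Rightarrow> real^'n^'m \<Rightarrow> real^'n^'m \<Rightarrow> real^'m^'m \<Rightarrow>
   (real^'n^'m \<Rightarrow> complex) \<Rightarrow> (real^'n^'m \<Rightarrow> complex)" where
  "schroedinger_W M l \<mu> \<kappa> f = (\<lambda>x.
     exp (of_real pi * \<i> *
       of_real (trace (M ** (\<kappa> + \<mu> ** transpose l + 2 *\<^sub>R (x ** transpose \<mu>))))) *
     f (x + l))"

definition R_at_i ::
  "real^'m^'m \<Rightarrow> real \<Rightarrow> (real^'n^'m \<Rightarrow> complex) \<Rightarrow> (real^'n^'m \<Rightarrow> complex)" where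
  "R_at_i M \<phi> f = (\<lambda>x.
     if [\<phi> = 0] (rmod (2 * pi)) then f x
     else if [\<phi> = pi] (rmod (2 * pi)) then f (- x)
     else of_real (det M powr (real CARD('n) / 2) *
            \<bar>sin \<phi>\<bar> powr (- (real CARD('m) * real CARD('n) / 2))) *
          (LINT y|lborel.
             exp (of_real pi * \<i> * of_real
               ((((norm_M M x)\<^sup>2 + (norm_M M y)\<^sup>2) * cos \<phi> - 2 * inner_M M x y) / sin \<phi>)) *
             f y))"

definition R_op ::
  "real^'m^'m \<Rightarrow> complex \<Rightarrow> real \<Rightarrow> (real^'n^'m \<Rightarrow> complex) \<Rightarrow> (real^'n^'m \<Rightarrow> complex)" where
  "R_op M \<tau> \<phi> f = (\<lambda>x.
     of_real (Im \<tau> powr (real CARD('m) * real CARD('n) / 4)) *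
     exp (of_real pi * \<i> * of_real (Re \<tau> * (norm_M M x)\<^sup>2)) *
     R_at_i M \<phi> f (sqrt (Im \<tau>) *\<^sub>R x))"

definition theta_sum ::
  "real^'m^'m \<Rightarrow> (real^'n^'m \<Rightarrow> complex) \<Rightarrow> complex \<Rightarrow> real \<Rightarrow>
   real^'n^'m \<Rightarrow> real^'n^'m \<Rightarrow> real^'m^'m \<Rightarrow> complex" where
  "theta_sum M f \<tau> \<phi> l \<mu> \<kappa> =
     (\<Sum>\<^sub>\<infinity>\<omega>\<in>integral_matrices. schroedinger_W M l \<mu> \<kappa> (R_op M \<tau> \<phi> f) \<omega>)"

end

theory Submission
  imports Defs
begin

text \<open>The identity holds term by term, before any summation. Write \<open>[x, y]\<close> for
  \<^term>\<open>inner_M M x y\<close>. The phase of the Schroedinger operator at \<open>\<omega>\<close> is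
  \<open>\<pi> \<i> (trace (M \<kappa>) + [l, \<mu>] + 2 [\<mu>, \<omega>])\<close>, and replacing \<open>\<tau>\<close> by \<open>\<tau> + 2\<close> merely multiplies the
  function in \<open>x\<close> by \<open>exp (2 \<pi> \<i> [x, x])\<close>, here with \<open>x = \<omega> + l\<close>. Completing the square,
  \<open>2 [\<omega> + l, \<omega> + l] = 2 [\<omega>, \<omega>] + 4 [l, \<omega>] + 2 [l, l]\<close>: the shift of \<open>\<mu>\<close> by \<open>- 2 l\<close> removes the
  last two summands, and the correction of \<open>\<kappa>\<close> removes the term \<open>[l, s]\<close> which the shift of \<open>\<mu>\<close>
  by \<open>s\<close> produces. What remains in the exponent is \<open>2 \<pi> \<i> ([\<omega>, \<omega>] + [s, \<omega>])\<close>, and its exponential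
  is \<open>1\<close> because \<open>M\<close>, \<open>s\<close> and \<open>\<omega>\<close> are integral.\<close>

lemma inner_M_add_left: "inner_M M (x + y) z = inner_M M x z + inner_M M y z"
  by (simp add: inner_M_def transpose_def matrix_matrix_mult_def trace_def sum.distrib algebra_simps)

lemma inner_M_scaleR_left: "inner_M M (c *\<^sub>R x) z = c * inner_M M x z"
  by (simp add: inner_M_def transpose_def matrix_matrix_mult_def trace_def sum_distrib_left
      sum_distrib_right mult_ac)

lemma inner_M_commute:
  assumes "symmetric_matrix M"
  shows "inner_M M x y = inner_M M y x"
proof -
  have "inner_M M x y = trace (transpose (transpose x ** M ** y))"
    by (simp add: inner_M_def trace_def transpose_def)
  also have "\<dots> = inner_M M y x"
    using assms
    by (simp add: inner_M_def symmetric_matrix_def matrix_transpose_mul matrix_mul_assoc)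
  finally show ?thesis .
qed

text \<open>The quantity \<open>[x, x]\<close> is the sum of the values of the quadratic form of \<open>M\<close> on the columns
  of \<open>x\<close>; so the square root in \<^const>\<open>norm_M\<close> is that of a nonnegative number.\<close>

lemma inner_M_nonneg:
  assumes "pos_def_matrix M"
  shows "inner_M M x x \<ge> 0"
proof -
  have "inner_M M x x = (\<Sum>j\<in>UNIV. column j x \<bullet> (M *v column j x))"
    unfolding inner_M_def matrix_mul_assoc[symmetric]
    by (simp add: trace_def matrix_matrix_mult_def transpose_def column_def inner_vec_def
        matrix_vector_mult_def)
  moreover have "v \<bullet> (M *v v) \<ge> 0" for v
    using assms by (cases "v = 0") (auto simp: pos_def_matrix_def intro: less_imp_le)
  ultimately show ?thesis
    by (simp add: sum_nonneg)
qed

lemma norm_M_squared: "pos_def_matrix M \<Longrightarrow> (norm_M M x)\<^sup>2 = inner_M M x x"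
  by (simp add: norm_M_def inner_M_nonneg)

lemma inner_M_in_Ints:
  assumes "M \<in> integral_matrices" "x \<in> integral_matrices" "y \<in> integral_matrices"
  shows "inner_M M x y \<in> \<int>"
  using assms
  by (auto simp: inner_M_def integral_matrices_def trace_def matrix_matrix_mult_def transpose_def
      intro!: Ints_sum Ints_mult)

text \<open>Cyclic invariance of the trace.\<close>

lemma trace_mult_transpose_eq_inner_M: "trace (M ** (y ** transpose x)) = inner_M M x y"
  unfolding inner_M_def by (metis matrix_mul_assoc trace_mul_sym)

lemma schroedinger_W_eq_inner_M:
  "schroedinger_W M l \<mu> \<kappa> g x =
     exp (of_real pi * \<i> *
       of_real (trace (M ** \<kappa>) + inner_M M l \<mu> + 2 * inner_M M \<mu> x)) * g (x + l)"
proof -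
  have "trace (M ** (2 *\<^sub>R A)) = 2 * trace (M ** A)" for A
    by (simp add: trace_def sum_distrib_left matrix_scalar_ac flip: scalar_matrix_assoc)
  then show ?thesis
    by (simp add: schroedinger_W_def matrix_add_ldistrib trace_add trace_mult_transpose_eq_inner_M)
qed

lemma R_op_translate:
  assumes "pos_def_matrix M"
  shows "R_op M (\<tau> + of_real r) \<phi> f x =
           exp (of_real pi * \<i> * of_real (r * inner_M M x x)) * R_op M \<tau> \<phi> f x"
  by (simp add: R_op_def norm_M_squared[OF assms] algebra_simps exp_add)

theorem theorem3p2:
  fixes M :: "real^'m^'m" and s l \<mu> :: "real^'n^'m" and \<kappa> :: "real^'m^'m"
    and f :: "real^'n^'m \<Rightarrow> complex" and \<tau> :: complex and \<phi> :: real
  assumes "symmetric_matrix M" and "pos_def_matrix M" and "M \<in> integral_matrices"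
    and "s \<in> integral_matrices"
    and "f \<in> schwartz_space"
    and "Im \<tau> > 0" and "\<phi> \<in> {0..<2 * pi}"
    and "(l, \<mu>, \<kappa>) \<in> heisenberg"
  shows "theta_sum M f (\<tau> + 2) \<phi> l (s - 2 *\<^sub>R l + \<mu>) (\<kappa> - s ** transpose l)
       = theta_sum M f \<tau> \<phi> l \<mu> \<kappa>"
  unfolding theta_sum_def
proof (rule infsum_cong)
  fix \<omega> :: "real^'n^'m"
  assume \<omega>: "\<omega> \<in> integral_matrices"
  define \<mu>' where "\<mu>' = s - 2 *\<^sub>R l + \<mu>"
  define \<kappa>' where "\<kappa>' = \<kappa> - s ** transpose l"
  define k where "k = inner_M M \<omega> \<omega> + inner_M M s \<omega>"
  note commute = inner_M_commute[OF assms(1)]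
  have add_right: "inner_M M x (y + z) = inner_M M x y + inner_M M x z" for x y z :: "real^'n^'m"
    by (metis commute inner_M_add_left)
  have \<mu>'_left: "inner_M M \<mu>' z = inner_M M s z - 2 * inner_M M l z + inner_M M \<mu> z" for z
  proof -
    have "\<mu>' = s + (-2) *\<^sub>R l + \<mu>"
      by (simp add: \<mu>'_def)
    then show ?thesis
      by (simp only: inner_M_add_left inner_M_scaleR_left)
  qed
  have "\<kappa> = \<kappa>' + s ** transpose l"
    by (simp add: \<kappa>'_def)
  then have \<kappa>': "trace (M ** \<kappa>) = trace (M ** \<kappa>') + inner_M M l s"
    by (simp add: matrix_add_ldistrib trace_add trace_mult_transpose_eq_inner_M)
  have exponent: "trace (M ** \<kappa>') + inner_M M l \<mu>' + 2 * inner_M M \<mu>' \<omega>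
        + 2 * inner_M M (\<omega> + l) (\<omega> + l)
      = trace (M ** \<kappa>) + inner_M M l \<mu> + 2 * inner_M M \<mu> \<omega> + 2 * k"
    using commute[of l \<mu>'] commute[of l \<mu>] commute[of l s] commute[of \<omega> l] \<mu>'_left[of l] \<mu>'_left[of \<omega>] \<kappa>'
    by (simp add: k_def inner_M_add_left add_right)
  have "k \<in> \<int>"
    using assms(3,4) \<omega> by (auto simp: k_def intro!: Ints_add inner_M_in_Ints)
  then have unit: "exp (of_real pi * \<i> * of_real (2 * k)) = (1 :: complex)"
    using exp_integer_2pi[of "of_real k"] by (auto elim!: Ints_cases simp: mult_ac)
  have translate: "R_op M (\<tau> + 2) \<phi> f x
      = exp (of_real pi * \<i> * of_real (2 * inner_M M x x)) * R_op M \<tau> \<phi> f x" for x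
    using R_op_translate[OF assms(2), of \<tau> 2] by simp
  have "schroedinger_W M l \<mu>' \<kappa>' (R_op M (\<tau> + 2) \<phi> f) \<omega>
      = exp (of_real pi * \<i> * of_real (trace (M ** \<kappa>') + inner_M M l \<mu>' + 2 * inner_M M \<mu>' \<omega>
          + 2 * inner_M M (\<omega> + l) (\<omega> + l))) * R_op M \<tau> \<phi> f (\<omega> + l)"
    by (simp add: schroedinger_W_eq_inner_M translate distrib_left exp_add)
  also have "\<dots> = schroedinger_W M l \<mu> \<kappa> (R_op M \<tau> \<phi> f) \<omega>"
    unfolding exponent schroedinger_W_eq_inner_M of_real_add[of _ "2 * k"] distrib_left[of "of_real pi * \<i>"]
      exp_add unit by simp
  finally show "schroedinger_W M l (s - 2 *\<^sub>R l + \<mu>) (\<kappa> - s ** transpose l) (R_op M (\<tau> + 2) \<phi> f) \<omega>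
      = schroedinger_W M l \<mu> \<kappa> (R_op M \<tau> \<phi> f) \<omega>"
    unfolding \<mu>'_def \<kappa>'_def .
qed

end
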